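(* Let $\varepsilon>0$. Then there exist a complex Hilbert space $H$ and a uniformly Kreiss bounded operator $T\in B(H)$ such that $\|T^k\|\ge \frac{1}{3}(k+1)^{1-\varepsilon}$ for all $k\in\mathbb{N}$.
   Context: $B(H)$ denotes the space of all bounded linear operators on $H$. An operator $T\in B(H)$ is uniformly Kreiss bounded if there exists $C>0$ such that $\left\|\sum_{k=0}^{n}\lambda^{-k-1}T^k\right\|\le \frac{C}{|\lambda|-1}$ for all $n\in\mathbb{N}$ and all $\lambda\in\mathbb{C}$ with $|\lambda|>1$. *)

theory Defs
  imports "HOL-Analysis.Analysis" "HOL-Algebra.Module"
begin

text \<open>
  Spaces are carrier-based, so that the existence of a Hilbert space can be expressed inside the
  logic. Modules over the field of complex numbers are complex vector spaces; the multiplicative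
  fields that \<^type>\<open>Module.module\<close> inherits from rings are irrelevant.
\<close>

definition complex_field :: "complex ring" where
  "complex_field = \<lparr>carrier = UNIV, mult = (*), one = 1, zero = 0, add = (+)\<rparr>"

lemma complex_field_simps [simp]:
  "carrier complex_field = UNIV" "mult complex_field = (*)" "one complex_field = 1"
  "zero complex_field = 0" "add complex_field = (+)"
  by (simp_all add: complex_field_def)

lemma field_complex_field: "field complex_field"
proof -
  have "abelian_group complex_field"
  proof (rule abelian_groupI)
    fix x assume "x \<in> carrier complex_field"
    show "\<exists>y\<in>carrier complex_field. y \<oplus>\<^bsub>complex_field\<^esub> x = \<zero>\<^bsub>complex_field\<^esub>"
      by (rule bexI[of _ "- x"]) simp_all
  qed simp_all
  moreover have "comm_monoid complex_field"
    by (rule comm_monoidI) simp_all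
  ultimately have "cring complex_field"
    by (rule cringI) (simp add: distrib_right)
  then show ?thesis
  proof (rule cring.cring_fieldI2)
    fix a assume "a \<in> carrier complex_field" "a \<noteq> \<zero>\<^bsub>complex_field\<^esub>"
    then show "\<exists>b\<in>carrier complex_field.
        a \<otimes>\<^bsub>complex_field\<^esub> b = \<one>\<^bsub>complex_field\<^esub>"
      by (intro bexI[of _ "inverse a"]) simp_all
  qed simp
qed

record 'a inner_prod_space = "(complex, 'a) Module.module" +
  inner_prod :: "'a \<Rightarrow> 'a \<Rightarrow> complex"

definition ip_norm :: "('a, 'b) inner_prod_space_scheme \<Rightarrow> 'a \<Rightarrow> real" where
  "ip_norm H x = sqrt (Re (inner_prod H x x))"

text \<open>The locale \<^locale>\<open>Metric_space\<close> requires symmetry also outside of the carrier, hence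
  the case distinction.\<close>

definition ip_dist :: "('a, 'b) inner_prod_space_scheme \<Rightarrow> 'a \<Rightarrow> 'a \<Rightarrow> real" where
  "ip_dist H x y = (if x \<in> carrier H \<and> y \<in> carrier H then ip_norm H (x \<ominus>\<^bsub>H\<^esub> y) else 0)"

text \<open>The inner product is linear in its first argument.\<close>

locale complex_inner_prod_space = Module.module complex_field H
  for H :: "('a, 'b) inner_prod_space_scheme" (structure) +
  assumes ip_add_left: "\<lbrakk>x \<in> carrier H; y \<in> carrier H; z \<in> carrier H\<rbrakk> \<Longrightarrow>
      inner_prod H (x \<oplus> y) z = inner_prod H x z + inner_prod H y z"
    and ip_smult_left: "\<lbrakk>x \<in> carrier H; y \<in> carrier H\<rbrakk> \<Longrightarrow>
      inner_prod H (c \<odot> x) y = c * inner_prod H x y"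
    and ip_cnj: "\<lbrakk>x \<in> carrier H; y \<in> carrier H\<rbrakk> \<Longrightarrow>
      inner_prod H x y = cnj (inner_prod H y x)"
    and ip_pos: "\<lbrakk>x \<in> carrier H; x \<noteq> \<zero>\<rbrakk> \<Longrightarrow> 0 < Re (inner_prod H x x)"

locale complex_hilbert_space = complex_inner_prod_space +
  assumes complete: "Metric_space.mcomplete (carrier H) (ip_dist H)"

definition bounded_operators :: "('a, 'b) inner_prod_space_scheme \<Rightarrow> ('a \<Rightarrow> 'a) set" where
  "bounded_operators H = {T. T \<in> carrier H \<rightarrow> carrier H
     \<and> (\<forall>x\<in>carrier H. \<forall>y\<in>carrier H. T (x \<oplus>\<^bsub>H\<^esub> y) = T x \<oplus>\<^bsub>H\<^esub> T y)
     \<and> (\<forall>c. \<forall>x\<in>carrier H. T (c \<odot>\<^bsub>H\<^esub> x) = c \<odot>\<^bsub>H\<^esub> T x)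
     \<and> (\<exists>B. \<forall>x\<in>carrier H. ip_norm H (T x) \<le> B * ip_norm H x)}"

definition op_norm :: "('a, 'b) inner_prod_space_scheme \<Rightarrow> ('a \<Rightarrow> 'a) \<Rightarrow> real" where
  "op_norm H T = (SUP x\<in>{x \<in> carrier H. ip_norm H x \<le> 1}. ip_norm H (T x))"

definition uniformly_kreiss_bounded ::
  "('a, 'b) inner_prod_space_scheme \<Rightarrow> ('a \<Rightarrow> 'a) \<Rightarrow> bool" where
  "uniformly_kreiss_bounded H T \<longleftrightarrow> (\<exists>C>0. \<forall>n::nat. \<forall>\<mu>::complex. cmod \<mu> > 1 \<longrightarrow>
     op_norm H (\<lambda>x. \<Oplus>\<^bsub>H\<^esub>k\<in>{0..n}. (\<mu> powi (- int k - 1)) \<odot>\<^bsub>H\<^esub> (T ^^ k) x)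
       \<le> C / (cmod \<mu> - 1))"

context complex_inner_prod_space
begin

lemma ip_zero_left [simp]:
  assumes "y \<in> carrier H" shows "inner_prod H \<zero> y = 0"
proof -
  have "0 \<odot> \<zero> = \<zero>" using smult_l_null[of \<zero>] by simp
  then show ?thesis using ip_smult_left[of \<zero> y 0] assms by simp
qed

lemma smult_closed' [simp, intro]: "x \<in> carrier H \<Longrightarrow> c \<odot> x \<in> carrier H"
  using smult_closed[of c x] by simp

lemma ip_add_right:
  assumes "x \<in> carrier H" "y \<in> carrier H" "z \<in> carrier H"
  shows "inner_prod H x (y \<oplus> z) = inner_prod H x y + inner_prod H x z"
  using assms ip_cnj[of x "y \<oplus> z"] ip_cnj[of x y] ip_cnj[of x z] by (simp add: ip_add_left)

lemma ip_smult_right: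
  assumes "x \<in> carrier H" "y \<in> carrier H"
  shows "inner_prod H x (c \<odot> y) = cnj c * inner_prod H x y"
  using assms ip_cnj[of x "c \<odot> y"] ip_cnj[of x y] by (simp add: ip_smult_left)

lemma ip_self:
  assumes "x \<in> carrier H" shows "inner_prod H x x = of_real ((ip_norm H x)\<^sup>2)"
proof -
  have "Re (inner_prod H x x) \<ge> 0"
    using assms ip_pos[of x] by (cases "x = \<zero>") auto
  moreover have "Im (inner_prod H x x) = 0"
    using arg_cong[OF ip_cnj[OF assms assms], of Im] by (metis cnj.sel(2) equal_neg_zero)
  ultimately show ?thesis by (simp add: ip_norm_def complex_eq_iff)
qed

lemma ip_norm_nonneg:
  assumes "x \<in> carrier H" shows "0 \<le> ip_norm H x"
  using assms ip_pos[of x] by (cases "x = \<zero>") (auto simp: ip_norm_def)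

lemma ip_norm_eq_0_iff:
  assumes "x \<in> carrier H" shows "ip_norm H x = 0 \<longleftrightarrow> x = \<zero>"
  using assms ip_pos[of x] by (cases "x = \<zero>") (auto simp: ip_norm_def)

lemma cauchy_schwarz:
  assumes x: "x \<in> carrier H" and y: "y \<in> carrier H"
  shows "cmod (inner_prod H x y) \<le> ip_norm H x * ip_norm H y"
proof (cases "y = \<zero>")
  case True
  then show ?thesis using x y ip_cnj[of x \<zero>] by (simp add: ip_norm_nonneg)
next
  case False
  define a where "a = inner_prod H x y"
  define n where "n = (ip_norm H y)\<^sup>2"
  have n: "n > 0" using False y ip_norm_eq_0_iff n_def by simp
  define c where "c = - (a / of_real n)"
  have yx: "inner_prod H y x = cnj a" using ip_cnj[OF y x] a_def by simp
  have "inner_prod H (x \<oplus> c \<odot> y) (x \<oplus> c \<odot> y)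
      = of_real ((ip_norm H x)\<^sup>2) + cnj c * a + c * cnj a + c * cnj c * of_real n"
    using x y yx ip_self[OF x] ip_self[OF y]
    by (simp add: ip_add_left ip_add_right ip_smult_left ip_smult_right a_def n_def algebra_simps)
  also have "\<dots> = of_real ((ip_norm H x)\<^sup>2) - a * cnj a / of_real n"
    using n by (simp add: c_def field_simps)
  also have "\<dots> = of_real ((ip_norm H x)\<^sup>2 - (cmod a)\<^sup>2 / n)"
    by (simp only: complex_norm_square[symmetric] of_real_diff of_real_divide of_real_power)
  finally have "(ip_norm H (x \<oplus> c \<odot> y))\<^sup>2 = (ip_norm H x)\<^sup>2 - (cmod a)\<^sup>2 / n"
    using x y ip_self[of "x \<oplus> c \<odot> y"] by (metis M.add.m_closed smult_closed' of_real_eq_iff)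
  then have "(cmod a)\<^sup>2 / n \<le> (ip_norm H x)\<^sup>2"
    by (metis diff_ge_0_iff_ge zero_le_power2)
  then have "(cmod a)\<^sup>2 \<le> (ip_norm H x * ip_norm H y)\<^sup>2"
    using n by (simp add: field_simps n_def)
  then show ?thesis
    using x y by (simp add: a_def abs_le_square_iff[symmetric] ip_norm_nonneg)
qed

lemma ip_norm_triangle:
  assumes x: "x \<in> carrier H" and y: "y \<in> carrier H"
  shows "ip_norm H (x \<oplus> y) \<le> ip_norm H x + ip_norm H y"
proof -
  have "complex_of_real ((ip_norm H (x \<oplus> y))\<^sup>2) = of_real ((ip_norm H x)\<^sup>2)
      + of_real ((ip_norm H y)\<^sup>2) + (inner_prod H x y + cnj (inner_prod H x y))"
    using x y ip_self[of "x \<oplus> y"] ip_self[OF x] ip_self[OF y] ip_cnj[OF y x]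
    by (simp add: ip_add_left ip_add_right algebra_simps)
  then have "(ip_norm H (x \<oplus> y))\<^sup>2
      = (ip_norm H x)\<^sup>2 + (ip_norm H y)\<^sup>2 + 2 * Re (inner_prod H x y)"
    by (simp only: complex_add_cnj of_real_add[symmetric] of_real_eq_iff)
  also have "\<dots> \<le> (ip_norm H x + ip_norm H y)\<^sup>2"
    using cauchy_schwarz[OF x y] complex_Re_le_cmod[of "inner_prod H x y"]
    by (simp add: power2_sum)
  finally show ?thesis
    by (rule power2_le_imp_le) (simp add: x y ip_norm_nonneg)
qed

lemma ip_norm_smult:
  assumes "x \<in> carrier H" shows "ip_norm H (c \<odot> x) = cmod c * ip_norm H x"
proof -
  have "complex_of_real ((ip_norm H (c \<odot> x))\<^sup>2) = c * cnj c * of_real ((ip_norm H x)\<^sup>2)"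
    using assms ip_self[of "c \<odot> x"] ip_self[OF assms]
    by (simp add: ip_smult_left ip_smult_right mult_ac)
  also have "\<dots> = of_real ((cmod c * ip_norm H x)\<^sup>2)"
    by (simp add: complex_norm_square[symmetric] power_mult_distrib)
  finally have "(ip_norm H (c \<odot> x))\<^sup>2 = (cmod c * ip_norm H x)\<^sup>2"
    using of_real_eq_iff by blast
  then show ?thesis using assms by (simp add: ip_norm_nonneg)
qed

sublocale metric: Metric_space "carrier H" "ip_dist H"
proof
  fix x y z
  show "0 \<le> ip_dist H x y" by (simp add: ip_dist_def ip_norm_nonneg)
  have neg: "\<ominus> v = (- 1) \<odot> v" if "v \<in> carrier H" for v
  proof -
    have "(- 1) \<odot> v \<oplus> v = \<zero>"
      using that smult_l_distr[of "- 1" 1 v] smult_l_null[of v] smult_one[of v] by simp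
    then show ?thesis using that by (simp add: M.minus_equality)
  qed
  show "ip_dist H x y = ip_dist H y x"
  proof (cases "x \<in> carrier H \<and> y \<in> carrier H")
    case True
    then have "y \<ominus> x = (- 1) \<odot> (x \<ominus> y)"
      by (simp add: neg[symmetric] a_minus_def M.minus_add M.a_comm)
    then show ?thesis using True by (simp add: ip_dist_def ip_norm_smult)
  qed (auto simp: ip_dist_def)
  show "ip_dist H x y = 0 \<longleftrightarrow> x = y" if "x \<in> carrier H" "y \<in> carrier H"
  proof -
    have "x \<ominus> y = \<zero> \<longleftrightarrow> x = y"
      using that M.minus_equality[of x "\<ominus> y"] by (auto simp: a_minus_def M.r_neg)
    then show ?thesis using that by (simp add: ip_dist_def ip_norm_eq_0_iff)
  qed
  show "ip_dist H x z \<le> ip_dist H x y + ip_dist H y z"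
    if "x \<in> carrier H" "y \<in> carrier H" "z \<in> carrier H"
  proof -
    have "x \<ominus> z = (x \<ominus> y) \<oplus> (y \<ominus> z)"
      using that by (simp add: a_minus_def M.a_assoc M.r_neg1)
    then show ?thesis using that ip_norm_triangle[of "x \<ominus> y" "y \<ominus> z"]
      by (simp add: ip_dist_def)
  qed
qed

end

end

(* T is a direct sum of finite weighted shifts on l^2. With g = max 0 (1 - epsilon) < 1, the block of
   dimension N + 1 has a basis e_(p,q), p + q = N, and maps e_(p,q) to the multiple
   w(p+1,q-1) / w(p,q) of e_(p+1,q-1), where w(p,q) = ((p+1) / (q+1))^(g/2). Then T^N maps e_(0,N)
   to (N+1)^g e_(N,0). Since T has nonnegative entries, uniform Kreiss boundedness reduces to
   bounding the norm of sum r^k T^k by C / (1 - r) for 0 < r < 1. Schur's test with the weight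
   ((p+1) (q+1))^(-g/2) applies: both the row and the column condition become
   sum_(j <= p) r^(p-j) (j+1)^(-g) <= C / (1 - r) (p+1)^(-g), which follows from Chebyshev's sum
   inequality. *)

theory Submission
  imports Defs
begin

section \<open>The Hilbert space of square summable sequences\<close>

definition ell2 :: "(nat \<Rightarrow> complex) set" where
  "ell2 = {x. summable (\<lambda>n. (cmod (x n))\<^sup>2)}"

definition ell2_space :: "(nat \<Rightarrow> complex) inner_prod_space" where
  "ell2_space = \<lparr>carrier = ell2, mult = (\<lambda>x y. x), one = (\<lambda>n. 0),
     zero = (\<lambda>n. 0), add = (\<lambda>x y n. x n + y n), smult = (\<lambda>c x n. c * x n),
     inner_prod = (\<lambda>x y. \<Sum>n. x n * cnj (y n))\<rparr>"

lemma ell2_space_simps [simp]: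
  "carrier ell2_space = ell2" "zero ell2_space = (\<lambda>n. 0)"
  "add ell2_space = (\<lambda>x y n. x n + y n)" "smult ell2_space = (\<lambda>c x n. c * x n)"
  "inner_prod ell2_space = (\<lambda>x y. \<Sum>n. x n * cnj (y n))"
  by (simp_all add: ell2_space_def)

lemma ell2_zero [simp]: "(\<lambda>n. 0) \<in> ell2"
  by (simp add: ell2_def)

lemma ell2_add [simp]:
  assumes "x \<in> ell2" "y \<in> ell2"
  shows "(\<lambda>n. x n + y n) \<in> ell2"
proof -
  have "(cmod (x n + y n))\<^sup>2 \<le> 2 * (cmod (x n))\<^sup>2 + 2 * (cmod (y n))\<^sup>2" for n
  proof -
    have "(cmod (x n + y n))\<^sup>2 \<le> (cmod (x n) + cmod (y n))\<^sup>2"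
      by (intro power_mono norm_triangle_ineq) simp
    then show ?thesis
      using sum_squares_bound[of "cmod (x n)" "cmod (y n)"] by (simp add: power2_sum)
  qed
  moreover have "summable (\<lambda>n. 2 * (cmod (x n))\<^sup>2 + 2 * (cmod (y n))\<^sup>2)"
    using assms by (intro summable_add summable_mult) (auto simp: ell2_def)
  ultimately show ?thesis
    unfolding ell2_def mem_Collect_eq by (elim summable_comparison_test'[where N = 0]) simp
qed

lemma ell2_smult [simp]: "x \<in> ell2 \<Longrightarrow> (\<lambda>n. c * x n) \<in> ell2"
  by (simp add: ell2_def norm_mult power_mult_distrib summable_mult)

lemma ell2_diff [simp]:
  assumes "x \<in> ell2" "y \<in> ell2"
  shows "(\<lambda>n. x n - y n) \<in> ell2"
  using ell2_add[OF assms(1) ell2_smult[OF assms(2), of "- 1"]] by simp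

lemma ell2_summable_inner:
  assumes "x \<in> ell2" "y \<in> ell2"
  shows "summable (\<lambda>n. x n * cnj (y n))"
proof -
  have "cmod (x n * cnj (y n)) \<le> (cmod (x n))\<^sup>2 + (cmod (y n))\<^sup>2" for n
    using sum_squares_bound[of "cmod (x n)" "cmod (y n)"]
      mult_nonneg_nonneg[OF norm_ge_zero[of "x n"] norm_ge_zero[of "y n"]]
    unfolding norm_mult complex_mod_cnj by linarith
  moreover have "summable (\<lambda>n. (cmod (x n))\<^sup>2 + (cmod (y n))\<^sup>2)"
    using assms by (intro summable_add) (auto simp: ell2_def)
  ultimately show ?thesis
    by (elim summable_comparison_test'[where N = 0]) simp
qed

lemma ell2_inner_self:
  assumes "x \<in> ell2"
  shows "(\<Sum>n. x n * cnj (x n)) = of_real (\<Sum>n. (cmod (x n))\<^sup>2)"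
proof -
  have "(\<Sum>n. x n * cnj (x n)) = (\<Sum>n. of_real ((cmod (x n))\<^sup>2))"
    by (simp only: complex_norm_square)
  then show ?thesis
    using assms by (simp only: suminf_of_real ell2_def mem_Collect_eq)
qed

lemma ell2_norm:
  "x \<in> ell2 \<Longrightarrow> ip_norm ell2_space x = sqrt (\<Sum>n. (cmod (x n))\<^sup>2)"
  by (simp add: ip_norm_def ell2_inner_self)

lemma ell2_norm_sq:
  assumes "x \<in> ell2"
  shows "(ip_norm ell2_space x)\<^sup>2 = (\<Sum>n. (cmod (x n))\<^sup>2)"
  using assms by (simp add: ell2_norm suminf_nonneg ell2_def)

text \<open>Reduces membership and norm bounds to finite sections. Both the completeness proof and
  the Schur estimate thus only manipulate finite sums, with a bound uniform in
  \<open>N\<close>.\<close>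

lemma ell2_boundI:
  assumes "\<And>N. (\<Sum>n\<le>N. (cmod (x n))\<^sup>2) \<le> B\<^sup>2" "0 \<le> B"
  shows "x \<in> ell2" "ip_norm ell2_space x \<le> B"
proof -
  show x: "x \<in> ell2"
    unfolding ell2_def mem_Collect_eq
    by (rule bounded_imp_summable[where B = "B\<^sup>2"]) (use assms in auto)
  have "sum (\<lambda>n. (cmod (x n))\<^sup>2) {..<N} \<le> B\<^sup>2" for N
  proof -
    have "sum (\<lambda>n. (cmod (x n))\<^sup>2) {..<N} \<le> (\<Sum>n\<le>N. (cmod (x n))\<^sup>2)"
      by (rule sum_mono2) auto
    then show ?thesis using assms(1)[of N] by linarith
  qed
  then have "(\<Sum>n. (cmod (x n))\<^sup>2) \<le> B\<^sup>2"
    using x by (intro suminf_le_const) (auto simp: ell2_def)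
  then show "ip_norm ell2_space x \<le> B"
    using x assms(2) by (simp add: ell2_norm real_le_lsqrt suminf_nonneg ell2_def)
qed

lemma ell2_sum_le:
  assumes "x \<in> ell2" "finite I"
  shows "(\<Sum>n\<in>I. (cmod (x n))\<^sup>2) \<le> (ip_norm ell2_space x)\<^sup>2"
  unfolding ell2_norm_sq[OF assms(1)]
  using assms by (intro sum_le_suminf) (auto simp: ell2_def)

lemma ell2_coord_le:
  assumes "x \<in> ell2"
  shows "cmod (x n) \<le> ip_norm ell2_space x"
proof (rule power2_le_imp_le)
  show "(cmod (x n))\<^sup>2 \<le> (ip_norm ell2_space x)\<^sup>2"
    using ell2_sum_le[OF assms, of "{n}"] by simp
  show "0 \<le> ip_norm ell2_space x"
    using assms by (simp add: ell2_norm suminf_nonneg ell2_def)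
qed

section \<open>Inner product space axioms and completeness of l^2\<close>

lemma abelian_group_ell2: "abelian_group ell2_space"
proof (rule abelian_groupI)
  fix x assume "x \<in> carrier ell2_space"
  then show "\<exists>y\<in>carrier ell2_space. y \<oplus>\<^bsub>ell2_space\<^esub> x = \<zero>\<^bsub>ell2_space\<^esub>"
    using ell2_smult[of x "- 1"] by (intro bexI[of _ "\<lambda>n. - 1 * x n"]) auto
qed (auto simp: algebra_simps)

lemma complex_inner_prod_space_ell2: "complex_inner_prod_space ell2_space"
proof (rule complex_inner_prod_space.intro)
  show "Module.module complex_field ell2_space"
  proof (rule moduleI[OF _ abelian_group_ell2])
    show "cring complex_field"
      using field_complex_field by (simp add: field_def domain_def)
  qed (auto simp: algebra_simps)
  show "complex_inner_prod_space_axioms ell2_space"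
  proof (unfold_locales, goal_cases)
    case (1 x y z)
    then show ?case
      by (simp add: suminf_add ell2_summable_inner distrib_right)
  next
    case (2 x y c)
    then show ?case
      by (simp add: suminf_mult ell2_summable_inner mult.assoc)
  next
    case (3 x y)
    then have "(\<lambda>n. y n * cnj (x n)) sums (\<Sum>n. y n * cnj (x n))"
      by (intro summable_sums ell2_summable_inner) auto
    then have "(\<lambda>n. cnj (y n * cnj (x n))) sums cnj (\<Sum>n. y n * cnj (x n))"
      by (simp only: sums_cnj)
    then show ?case
      by (simp add: sums_iff mult.commute)
  next
    case (4 x)
    then obtain i where "x i \<noteq> 0" by auto
    then have "0 < (\<Sum>n. (cmod (x n))\<^sup>2)"
      using 4 by (intro suminf_pos2[of _ i]) (auto simp: ell2_def)
    then show ?case using 4 by (simp add: ell2_inner_self)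
  qed
qed

interpretation ell2: complex_inner_prod_space ell2_space
  by (rule complex_inner_prod_space_ell2)

lemma ell2_minus:
  assumes "x \<in> ell2" "y \<in> ell2"
  shows "x \<ominus>\<^bsub>ell2_space\<^esub> y = (\<lambda>n. x n - y n)"
proof -
  have "\<ominus>\<^bsub>ell2_space\<^esub> y = (\<lambda>n. - y n)"
    using assms ell2_smult[of y "- 1"] by (intro ell2.M.minus_equality) auto
  then show ?thesis by (simp add: a_minus_def)
qed

lemma ell2_dist:
  assumes "x \<in> ell2" "y \<in> ell2"
  shows "ip_dist ell2_space x y = ip_norm ell2_space (\<lambda>n. x n - y n)"
  using assms by (simp add: ip_dist_def ell2_minus)

lemma complex_hilbert_space_ell2: "complex_hilbert_space ell2_space"
proof (intro complex_hilbert_space.intro complex_inner_prod_space_ell2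
    complex_hilbert_space_axioms.intro)
  show "ell2.metric.mcomplete"
    unfolding ell2.metric.mcomplete_def
  proof (intro allI impI)
    fix \<sigma> assume "ell2.metric.MCauchy \<sigma>"
    then have "range \<sigma> \<subseteq> ell2"
      and cau: "\<forall>e>0. \<exists>N. \<forall>k l. N \<le> k \<longrightarrow> N \<le> l \<longrightarrow> ip_dist ell2_space (\<sigma> k) (\<sigma> l) < e"
      unfolding ell2.metric.MCauchy_def unfolding ell2_space_simps by blast+
    then have \<sigma>: "\<sigma> k \<in> ell2" for k by blast
    have "Cauchy (\<lambda>k. \<sigma> k n)" for n
    proof (rule metric_CauchyI)
      fix e :: real assume "e > 0"
      then obtain N where N: "\<And>k l. k \<ge> N \<Longrightarrow> l \<ge> N \<Longrightarrow> ip_dist ell2_space (\<sigma> k) (\<sigma> l) < e"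
        using cau by blast
      have "dist (\<sigma> k n) (\<sigma> l n) < e" if "k \<ge> N" "l \<ge> N" for k l
        using N[OF that] ell2_coord_le[OF ell2_diff[OF \<sigma>[of k] \<sigma>[of l]], of n] \<sigma>
        by (simp add: ell2_dist dist_norm)
      then show "\<exists>N. \<forall>k\<ge>N. \<forall>l\<ge>N. dist (\<sigma> k n) (\<sigma> l n) < e" by blast
    qed
    then have "\<exists>y. (\<lambda>k. \<sigma> k n) \<longlonglongrightarrow> y" for n
      by (metis Cauchy_convergent_iff convergent_def)
    then obtain y where y: "\<And>n. (\<lambda>k. \<sigma> k n) \<longlonglongrightarrow> y n" by metis
    have close: "\<exists>N. \<forall>k\<ge>N. (\<lambda>n. \<sigma> k n - y n) \<in> ell2 \<and>
        ip_norm ell2_space (\<lambda>n. \<sigma> k n - y n) \<le> e" if e: "e > 0" for e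
    proof -
      obtain N where N: "\<And>k l. k \<ge> N \<Longrightarrow> l \<ge> N \<Longrightarrow> ip_dist ell2_space (\<sigma> k) (\<sigma> l) < e"
        using cau e by blast
      \<comment> \<open>Only coordinatewise convergence is known so far, so the limit in
        \<open>l\<close> is taken in a finite section, with \<open>k\<close> and \<open>M\<close>
        fixed.\<close>
      have *: "(\<Sum>n\<le>M. (cmod (\<sigma> k n - y n))\<^sup>2) \<le> e\<^sup>2" if k: "k \<ge> N" for k M
      proof (rule LIMSEQ_le_const2)
        show "(\<lambda>l. \<Sum>n\<le>M. (cmod (\<sigma> k n - \<sigma> l n))\<^sup>2) \<longlonglongrightarrow> (\<Sum>n\<le>M. (cmod (\<sigma> k n - y n))\<^sup>2)"
          by (intro tendsto_intros y)
        have "(\<Sum>n\<le>M. (cmod (\<sigma> k n - \<sigma> l n))\<^sup>2) \<le> e\<^sup>2" if l: "l \<ge> N" for l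
        proof -
          have "(\<Sum>n\<le>M. (cmod (\<sigma> k n - \<sigma> l n))\<^sup>2) \<le> (ip_norm ell2_space (\<lambda>n. \<sigma> k n - \<sigma> l n))\<^sup>2"
            using ell2_sum_le[OF ell2_diff[OF \<sigma>[of k] \<sigma>[of l]], of "{..M}"] by simp
          also have "\<dots> \<le> e\<^sup>2"
            using N[OF k l] \<sigma> ell2.ip_norm_nonneg[of "\<lambda>n. \<sigma> k n - \<sigma> l n"]
            by (intro power_mono) (auto simp: ell2_dist)
          finally show ?thesis .
        qed
        then show "\<exists>N. \<forall>l\<ge>N. (\<Sum>n\<le>M. (cmod (\<sigma> k n - \<sigma> l n))\<^sup>2) \<le> e\<^sup>2" by blast
      qed
      show ?thesis
        using ell2_boundI[OF *] e by (intro exI[of _ N]) auto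
    qed
    obtain k where "(\<lambda>n. \<sigma> k n - y n) \<in> ell2" using close[of 1] by auto
    \<comment> \<open>The limit is the difference of \<open>\<sigma> k\<close> and
      \<open>\<sigma> k - y\<close>, both in l^2.\<close>
    then have y2: "y \<in> ell2" using ell2_diff[OF \<sigma>[of k]] by fastforce
    have "\<exists>N. \<forall>k\<ge>N. \<sigma> k \<in> carrier ell2_space \<and> ip_dist ell2_space (\<sigma> k) y < e"
      if "e > 0" for e
    proof -
      \<comment> \<open>Half of \<open>e\<close>, because \<open>close\<close> gives a weak
        inequality and a strict one is required.\<close>
      obtain N where "\<forall>k\<ge>N. ip_norm ell2_space (\<lambda>n. \<sigma> k n - y n) \<le> e / 2"
        using close[of "e / 2"] half_gt_zero[OF \<open>e > 0\<close>] by blast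
      then show ?thesis
        using that \<sigma> y2 by (intro exI[of _ N]) (force simp: ell2_dist)
    qed
    then show "\<exists>y. limitin ell2.metric.mtopology \<sigma> y sequentially"
      using y2 unfolding ell2.metric.limit_metric_sequentially by auto
  qed
qed

section \<open>Finite sums and operator norms on l^2\<close>

lemma ell2_finsum:
  assumes "finite A" "\<And>k. k \<in> A \<Longrightarrow> f k \<in> ell2"
  shows "(\<Oplus>\<^bsub>ell2_space\<^esub>k\<in>A. f k) = (\<lambda>n. \<Sum>k\<in>A. f k n)"
  using assms
proof (induction A rule: finite_induct)
  case (insert a A)
  then show ?case by (subst ell2.M.finsum_insert) auto
qed simp

lemma op_norm_ell2_le:
  assumes "\<And>x. x \<in> ell2 \<Longrightarrow> ip_norm ell2_space x \<le> 1 \<Longrightarrow> ip_norm ell2_space (S x) \<le> B"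
  shows "op_norm ell2_space S \<le> B"
  unfolding op_norm_def
proof (rule cSUP_least)
  have "(\<lambda>n. 0) \<in> {x \<in> carrier ell2_space. ip_norm ell2_space x \<le> 1}"
    by (simp add: ell2_norm)
  then show "{x \<in> carrier ell2_space. ip_norm ell2_space x \<le> 1} \<noteq> {}" by blast
qed (use assms in auto)

text \<open>The crude constant \<open>B\<close> does not enter the conclusion; it guarantees that
  the real supremum in \<open>op_norm\<close> is taken over a set that is bounded above.\<close>

lemma op_norm_ell2_ge:
  assumes "\<And>x. x \<in> ell2 \<Longrightarrow> ip_norm ell2_space (S x) \<le> B * ip_norm ell2_space x" "0 \<le> B"
    and "x \<in> ell2" "ip_norm ell2_space x \<le> 1"
  shows "ip_norm ell2_space (S x) \<le> op_norm ell2_space S"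
  unfolding op_norm_def
proof (rule cSUP_upper)
  have "ip_norm ell2_space (S z) \<le> B" if "z \<in> ell2" "ip_norm ell2_space z \<le> 1" for z
    using assms(1)[OF that(1)] mult_left_mono[OF that(2) assms(2)] by simp
  then show "bdd_above ((\<lambda>x. ip_norm ell2_space (S x)) `
      {x \<in> carrier ell2_space. ip_norm ell2_space x \<le> 1})"
    by (intro bdd_aboveI[of _ B]) auto
qed (use assms in auto)

section \<open>Schur test and a convolution estimate\<close>

text \<open>Each entry is split as sqrt (A n m * p m) times sqrt (A n m / p m). Cauchy-Schwarz and
  the row condition bound one row; after interchanging the sums, the column condition removes the
  remaining \<open>p n\<close>.\<close>

lemma schur_test:
  fixes A :: "'i \<Rightarrow> 'i \<Rightarrow> real" and p f :: "'i \<Rightarrow> real"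
  assumes A: "\<And>n m. 0 \<le> A n m" and p: "\<And>n. 0 < p n" and R: "0 \<le> R"
    and row: "\<And>n. n \<in> I \<Longrightarrow> (\<Sum>m\<in>I. A n m * p m) \<le> R * p n"
    and col: "\<And>m. m \<in> I \<Longrightarrow> (\<Sum>n\<in>I. A n m * p n) \<le> R * p m"
  shows "(\<Sum>n\<in>I. (\<Sum>m\<in>I. A n m * f m)\<^sup>2) \<le> R\<^sup>2 * (\<Sum>m\<in>I. (f m)\<^sup>2)"
proof -
  have "(\<Sum>m\<in>I. A n m * f m)\<^sup>2 \<le> R * (\<Sum>m\<in>I. A n m * p n * ((f m)\<^sup>2 / p m))" if n: "n \<in> I" for n
  proof -
    have "A n m * f m = sqrt (A n m * p m) * (sqrt (A n m / p m) * f m)" for m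
      using A[of n m] p[of m] by (simp add: real_sqrt_mult real_sqrt_divide)
    then have "(\<Sum>m\<in>I. A n m * f m)\<^sup>2
        = (\<Sum>m\<in>I. sqrt (A n m * p m) * (sqrt (A n m / p m) * f m))\<^sup>2" by (simp only:)
    also have "\<dots> \<le> (\<Sum>m\<in>I. (sqrt (A n m * p m))\<^sup>2) * (\<Sum>m\<in>I. (sqrt (A n m / p m) * f m)\<^sup>2)"
      by (rule Cauchy_Schwarz_ineq_sum)
    also have "\<dots> = (\<Sum>m\<in>I. A n m * p m) * (\<Sum>m\<in>I. A n m * ((f m)\<^sup>2 / p m))"
      using A p less_imp_le[OF p] by (simp add: power_mult_distrib)
    also have "\<dots> \<le> (R * p n) * (\<Sum>m\<in>I. A n m * ((f m)\<^sup>2 / p m))"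
      using A p n by (intro mult_right_mono row sum_nonneg mult_nonneg_nonneg divide_nonneg_pos) auto
    also have "\<dots> = R * (\<Sum>m\<in>I. A n m * p n * ((f m)\<^sup>2 / p m))"
      by (simp add: sum_distrib_left mult_ac)
    finally show ?thesis .
  qed
  then have "(\<Sum>n\<in>I. (\<Sum>m\<in>I. A n m * f m)\<^sup>2)
      \<le> (\<Sum>n\<in>I. R * (\<Sum>m\<in>I. A n m * p n * ((f m)\<^sup>2 / p m)))"
    by (rule sum_mono)
  also have "\<dots> = R * (\<Sum>m\<in>I. (\<Sum>n\<in>I. A n m * p n) * ((f m)\<^sup>2 / p m))"
    unfolding sum_distrib_left[symmetric] sum_distrib_right by (subst sum.swap) simp
  also have "\<dots> \<le> R * (\<Sum>m\<in>I. (R * p m) * ((f m)\<^sup>2 / p m))"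
    using p R by (intro mult_left_mono sum_mono mult_right_mono col divide_nonneg_pos) auto
  also have "\<dots> = R\<^sup>2 * (\<Sum>m\<in>I. (f m)\<^sup>2)"
    using p[THEN less_imp_neq] by (simp add: power2_eq_square sum_distrib_left mult_ac)
  finally show ?thesis .
qed

text \<open>Discrete form of the integral of t^(-g) over [0, n], which is n^(1-g) / (1-g).\<close>

lemma sum_powr_le:
  fixes g :: real
  assumes "0 \<le> g" "g < 1"
  shows "(1 - g) * (\<Sum>k=0..<n. (real k + 1) powr (- g)) \<le> real n powr (1 - g)"
proof (induction n)
  case (Suc n)
  have "real n powr (1 - g) + (1 - g) * (real n + 1) powr (- g) \<le> (real n + 1) powr (1 - g)"
  proof (cases "n = 0")
    case False
    \<comment> \<open>Weighted AM-GM for n and n + 1. The right-hand side is n + 1 - (1 - g), so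
      multiplying by (n+1)^(-g) gives the increment needed for the induction.\<close>
    have "real n powr (1 - g) * (real n + 1) powr g \<le> (1 - g) * real n + g * (real n + 1)"
      using False assms by (intro Youngs_inequality_0) auto
    then have "real n powr (1 - g) * (real n + 1) powr g * (real n + 1) powr (- g)
        \<le> (real n + 1 - (1 - g)) * (real n + 1) powr (- g)"
      by (intro mult_right_mono) (auto simp: algebra_simps)
    moreover have "(real n + 1) powr g * (real n + 1) powr (- g) = 1"
      by (simp flip: powr_add)
    moreover have "(real n + 1) * (real n + 1) powr (- g) = (real n + 1) powr (1 - g)"
      using powr_add[of "real n + 1" 1 "- g"] by simp
    ultimately show ?thesis by (simp add: mult.assoc algebra_simps)
  qed (use assms in simp)
  then show ?case using Suc by (simp add: distrib_left add.commute)
qed simp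

text \<open>In \<open>k\<close>, the factor r^(p-k) is nondecreasing and (k+1)^(-g) nonincreasing,
  so Chebyshev bounds p + 1 times the sum of products by the product of the sums. These are at most
  1 / (1-r) and (p+1)^(1-g) / (1-g); cancelling p + 1 leaves (p+1)^(-g).\<close>

lemma sum_geometric_powr_le:
  fixes g r :: real
  assumes g: "0 \<le> g" "g < 1" and r: "0 \<le> r" "r < 1"
  shows "(\<Sum>k=0..<Suc p. r ^ (p - k) * (real k + 1) powr (- g))
    \<le> 1 / ((1 - g) * (1 - r)) * (real p + 1) powr (- g)"
proof -
  let ?n = "real p + 1"
  have "?n * (\<Sum>k=0..<Suc p. r ^ (p - k) * (real k + 1) powr (- g))
      \<le> (\<Sum>k=0..<Suc p. r ^ (p - k)) * (\<Sum>k=0..<Suc p. (real k + 1) powr (- g))"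
    using g r Chebyshev_sum_upper[of "Suc p" "\<lambda>k. r ^ (p - k)" "\<lambda>k. (real k + 1) powr (- g)"]
    by (simp add: power_decreasing powr_mono2' add.commute)
  also have "\<dots> \<le> 1 / (1 - r) * (?n powr (1 - g) / (1 - g))"
  proof (rule mult_mono)
    have "(\<Sum>k=0..<Suc p. r ^ (p - k)) = (\<Sum>k<Suc p. r ^ k)"
      by (rule sum.reindex_bij_witness[of _ "\<lambda>k. p - k" "\<lambda>k. p - k"]) auto
    also have "\<dots> = (1 - r ^ Suc p) / (1 - r)"
      using r by (simp only: sum_gp_strict) simp
    also have "\<dots> \<le> 1 / (1 - r)"
      using r by (intro divide_right_mono) auto
    finally show "(\<Sum>k=0..<Suc p. r ^ (p - k)) \<le> 1 / (1 - r)" .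
    show "(\<Sum>k=0..<Suc p. (real k + 1) powr (- g)) \<le> ?n powr (1 - g) / (1 - g)"
      using sum_powr_le[OF g, of "Suc p"] g by (simp add: pos_le_divide_eq mult.commute add.commute)
  qed (use g r in \<open>auto intro!: sum_nonneg simp del: sum.op_ivl_Suc\<close>)
  also have "?n powr (1 - g) = ?n * ?n powr (- g)"
    using powr_add[of ?n 1 "- g"] by simp
  finally have "?n * (\<Sum>k=0..<Suc p. r ^ (p - k) * (real k + 1) powr (- g))
      \<le> ?n * (1 / ((1 - g) * (1 - r)) * ?n powr (- g))"
    by (simp add: mult_ac)
  then show ?thesis by (rule mult_left_le_imp_le) simp
qed

section \<open>The weighted shift\<close>

text \<open>The number \<open>n\<close> stands for the basis vector with index \<open>pos n\<close> in the block of dimension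
  \<open>pos n + rem n + 1\<close>. Blocks are intervals of natural numbers and \<open>pos\<close> increases along them.\<close>

definition pos :: "nat \<Rightarrow> nat" where "pos n = fst (prod_decode n)"
definition rem :: "nat \<Rightarrow> nat" where "rem n = snd (prod_decode n)"

lemma prod_encode_pos_rem: "prod_encode (pos n, rem n) = n"
  by (simp add: pos_def rem_def)

lemma pos_prod_encode [simp]: "pos (prod_encode (p, q)) = p"
  by (simp add: pos_def)

lemma rem_prod_encode [simp]: "rem (prod_encode (p, q)) = q"
  by (simp add: rem_def)

lemma pos_le: "pos n \<le> n"
  using le_prod_encode_1[of "pos n" "rem n"] by (simp add: prod_encode_pos_rem)

text \<open>\<open>prod_encode (p, q)\<close> is the triangular number of p + q, plus p. On an
  antidiagonal the first summand is constant, so moving by k in the block moves the code by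
  k.\<close>

lemma pos_rem_diff:
  assumes "k \<le> pos n"
  shows "pos (n - k) = pos n - k" "rem (n - k) = rem n + k"
proof -
  have "n - k = prod_encode (pos n - k, rem n + k)"
    using assms prod_encode_pos_rem[of n] by (auto simp: prod_encode_def)
  then show "pos (n - k) = pos n - k" "rem (n - k) = rem n + k" by simp_all
qed

lemma pos_rem_add:
  assumes "k \<le> rem n"
  shows "pos (n + k) = pos n + k" "rem (n + k) = rem n - k"
proof -
  have "n + k = prod_encode (pos n + k, rem n - k)"
    using assms prod_encode_pos_rem[of n] by (auto simp: prod_encode_def)
  then show "pos (n + k) = pos n + k" "rem (n + k) = rem n - k" by simp_all
qed

definition weight :: "real \<Rightarrow> nat \<Rightarrow> real" where
  "weight b n = (real (pos n) + 1) powr b * (real (rem n) + 1) powr (- b)"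

text \<open>Division by \<open>weight\<close> cancels the \<open>rem\<close> factor and
  multiplication by it cancels the \<open>pos\<close> factor. Hence row sums become one-dimensional
  sums in \<open>pos\<close> and column sums become such sums in \<open>rem\<close>.\<close>

definition schur_weight :: "real \<Rightarrow> nat \<Rightarrow> real" where
  "schur_weight b n = (real (pos n) + 1) powr (- b) * (real (rem n) + 1) powr (- b)"

lemma weight_pos [simp]: "0 < weight b n"
  by (simp add: weight_def)

lemma schur_weight_pos [simp]: "0 < schur_weight b n"
  by (simp add: schur_weight_def)

lemma schur_weight_div_weight:
  "schur_weight b n / weight b n = (real (pos n) + 1) powr (- (2 * b))"
  by (simp add: schur_weight_def weight_def powr_minus field_simps flip: powr_add)

lemma weight_mult_schur_weight:
  "weight b n * schur_weight b n = (real (rem n) + 1) powr (- (2 * b))"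
  by (simp add: schur_weight_def weight_def powr_minus field_simps flip: powr_add)

text \<open>The value 0 at the first index of a block keeps the blocks separate, so that a single
  sequence space carries the whole direct sum.\<close>

definition wshift :: "real \<Rightarrow> (nat \<Rightarrow> complex) \<Rightarrow> nat \<Rightarrow> complex" where
  "wshift b x n = (if pos n = 0 then 0 else of_real (weight b n / weight b (n - 1)) * x (n - 1))"

text \<open>The quotients of consecutive weights telescope, and \<open>k \<le> pos n\<close> says
  that \<open>n - k\<close> is still in the block of \<open>n\<close>.\<close>

lemma wshift_funpow:
  "(wshift b ^^ k) x n =
    (if k \<le> pos n then of_real (weight b n / weight b (n - k)) * x (n - k) else 0)"
proof (induction k arbitrary: n)
  case 0
  then show ?case by (simp add: less_imp_neq[OF weight_pos, symmetric])
next
  case (Suc k)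
  have "(wshift b ^^ Suc k) x n = wshift b ((wshift b ^^ k) x) n" by simp
  also have "\<dots> = (if Suc k \<le> pos n then of_real (weight b n / weight b (n - Suc k)) * x (n - Suc k) else 0)"
  proof (cases "pos n = 0")
    case False
    then have "pos (n - 1) = pos n - 1" by (intro pos_rem_diff) simp
    with False show ?thesis
      by (auto simp: wshift_def[of b "(wshift b ^^ k) x"] Suc less_imp_neq[OF weight_pos, symmetric])
  qed (simp add: wshift_def)
  finally show ?case .
qed

text \<open>The matrix of the sum of r^k T^k over all k, where T is \<open>wshift b\<close>; the
  entry at (n, m) comes from k = n - m.\<close>

definition shift_kernel :: "real \<Rightarrow> real \<Rightarrow> nat \<Rightarrow> nat \<Rightarrow> real" where
  "shift_kernel b r n m = (if m \<le> n \<and> n - m \<le> pos n then r ^ (n - m) * (weight b n / weight b m) else 0)"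

lemma shift_kernel_eq_0:
  "m \<notin> {n - pos n..n} \<Longrightarrow> shift_kernel b r n m = 0"
  by (auto simp: shift_kernel_def)

text \<open>A row only looks back to the start of its block, so cutting the matrix at
  \<open>N \<ge> n\<close> loses nothing.\<close>

lemma shift_kernel_sum_row:
  assumes "n \<le> N"
  shows "(\<Sum>m\<le>N. shift_kernel b r n m * f m)
    = (\<Sum>k\<le>pos n. r ^ k * (weight b n / weight b (n - k)) * f (n - k))"
proof -
  have "(\<Sum>m\<le>N. shift_kernel b r n m * f m) = (\<Sum>m\<in>{n - pos n..n}. shift_kernel b r n m * f m)"
    using assms by (intro sum.mono_neutral_right) (auto simp: shift_kernel_eq_0)
  also have "\<dots> = (\<Sum>k\<le>pos n. r ^ k * (weight b n / weight b (n - k)) * f (n - k))"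
    using pos_le[of n]
    by (intro sum.reindex_bij_witness[of _ "\<lambda>k. n - k" "\<lambda>k. n - k"])
      (auto simp: shift_kernel_def)
  finally show ?thesis .
qed

section \<open>Schur's test for the kernel\<close>

context
  fixes b r :: real
  assumes b: "0 \<le> b" "2 * b < 1" and r: "0 \<le> r" "r < 1"
begin

lemma shift_kernel_row:
  assumes "n \<le> N"
  shows "(\<Sum>m\<le>N. shift_kernel b r n m * schur_weight b m)
    \<le> 1 / ((1 - 2 * b) * (1 - r)) * schur_weight b n"
proof -
  have "(\<Sum>m\<le>N. shift_kernel b r n m * schur_weight b m)
      = (\<Sum>k\<le>pos n. r ^ k * (weight b n / weight b (n - k)) * schur_weight b (n - k))"
    by (rule shift_kernel_sum_row[OF assms])
  also have "\<dots> = (\<Sum>k\<le>pos n. weight b n * (r ^ k * (real (pos n - k) + 1) powr (- (2 * b))))"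
  proof (intro sum.cong refl)
    fix k assume "k \<in> {..pos n}"
    then have "schur_weight b (n - k) / weight b (n - k) = (real (pos n - k) + 1) powr (- (2 * b))"
      unfolding schur_weight_div_weight by (simp only: pos_rem_diff atMost_iff)
    then show "r ^ k * (weight b n / weight b (n - k)) * schur_weight b (n - k)
        = weight b n * (r ^ k * (real (pos n - k) + 1) powr (- (2 * b)))"
      by (metis (no_types, opaque_lifting) mult.assoc mult.left_commute times_divide_eq_left times_divide_eq_right)
  qed
  \<comment> \<open>Reversing the order makes the index the position \<open>pos (n - k)\<close>, as
    in \<open>sum_geometric_powr_le\<close> with g = 2b.\<close>
  also have "\<dots> = weight b n * (\<Sum>k=0..<Suc (pos n). r ^ (pos n - k) * (real k + 1) powr (- (2 * b)))"
    unfolding sum_distrib_left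
    by (rule sum.reindex_bij_witness[of _ "\<lambda>k. pos n - k" "\<lambda>k. pos n - k"]) auto
  also have "\<dots> \<le> weight b n * (1 / ((1 - 2 * b) * (1 - r)) * (real (pos n) + 1) powr (- (2 * b)))"
    using b r by (intro mult_left_mono sum_geometric_powr_le less_imp_le[OF weight_pos]) auto
  also have "\<dots> = 1 / ((1 - 2 * b) * (1 - r)) * schur_weight b n"
    by (simp add: less_imp_neq[OF weight_pos, symmetric] flip: schur_weight_div_weight)
  finally show ?thesis .
qed

lemma shift_kernel_col:
  "(\<Sum>n\<le>N. shift_kernel b r n m * schur_weight b n)
    \<le> 1 / ((1 - 2 * b) * (1 - r)) * schur_weight b m"
proof -
  \<comment> \<open>Here m lies in the block of n, hence \<open>rem m\<close> equals
    \<open>rem n\<close> plus n - m.\<close>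
  have in_block: "n - m \<le> rem m" if "m \<le> n" "n - m \<le> pos n" for n
    using pos_rem_diff(2)[OF that(2)] that(1) by simp
  have "(\<Sum>n\<le>N. shift_kernel b r n m * schur_weight b n)
      = (\<Sum>n\<in>{n. n \<le> N \<and> m \<le> n \<and> n - m \<le> pos n}. shift_kernel b r n m * schur_weight b n)"
    by (intro sum.mono_neutral_right) (auto simp: shift_kernel_def)
  \<comment> \<open>Unlike a row, a column can be cut off by \<open>N\<close>; completing it to the
    end of the block only adds nonnegative terms.\<close>
  also have "\<dots> \<le> (\<Sum>n\<in>{m..m + rem m}. shift_kernel b r n m * schur_weight b n)"
    using in_block r less_imp_le[OF weight_pos] less_imp_le[OF schur_weight_pos]
    by (intro sum_mono2) (force simp: shift_kernel_def)+
  \<comment> \<open>The new index k is \<open>rem n\<close>.\<close>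
  also have "\<dots> = (\<Sum>k=0..<Suc (rem m). 1 / weight b m * (r ^ (rem m - k) * (real k + 1) powr (- (2 * b))))"
  proof (rule sum.reindex_bij_witness[of _ "\<lambda>k. m + (rem m - k)" "\<lambda>n. rem m - (n - m)"])
    fix n assume n: "n \<in> {m..m + rem m}"
    define k where "k = n - m"
    have nk: "n = m + k" "k \<le> rem m" using n by (auto simp: k_def)
    then have "pos n = pos m + k" "rem n = rem m - k" using pos_rem_add[OF nk(2)] by simp_all
    then show "1 / weight b m * (r ^ (rem m - (rem m - (n - m))) *
        (real (rem m - (n - m)) + 1) powr (- (2 * b))) = shift_kernel b r n m * schur_weight b n"
      using nk weight_mult_schur_weight[of b n] by (simp add: shift_kernel_def)
  qed auto
  also have "\<dots> \<le> 1 / weight b m * (1 / ((1 - 2 * b) * (1 - r)) * (real (rem m) + 1) powr (- (2 * b)))"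
    unfolding sum_distrib_left[symmetric]
    using b r less_imp_le[OF weight_pos] by (intro mult_left_mono sum_geometric_powr_le) auto
  also have "\<dots> = 1 / ((1 - 2 * b) * (1 - r)) * schur_weight b m"
    by (simp add: less_imp_neq[OF weight_pos, symmetric] flip: weight_mult_schur_weight)
  finally show ?thesis .
qed

text \<open>Stated for any entrywise dominated \<open>y\<close>, so that it serves both for single
  powers of the shift and for the Kreiss sums with complex coefficients.\<close>

lemma shift_kernel_dominated:
  assumes x: "x \<in> ell2" and c: "0 \<le> c"
    and y: "\<And>n. cmod (y n)
      \<le> c * (\<Sum>k\<le>pos n. r ^ k * (weight b n / weight b (n - k)) * cmod (x (n - k)))"
  shows "y \<in> ell2"
    and "ip_norm ell2_space y \<le> c * (1 / ((1 - 2 * b) * (1 - r))) * ip_norm ell2_space x"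
proof -
  define R where "R = 1 / ((1 - 2 * b) * (1 - r))"
  have R: "0 \<le> R" using b r by (simp add: R_def)
  have "(\<Sum>n\<le>N. (cmod (y n))\<^sup>2) \<le> (c * R * ip_norm ell2_space x)\<^sup>2" for N
  proof -
    have "(\<Sum>n\<le>N. (cmod (y n))\<^sup>2) \<le> (\<Sum>n\<le>N. (c * (\<Sum>m\<le>N. shift_kernel b r n m * cmod (x m)))\<^sup>2)"
    proof (intro sum_mono power_mono)
      fix n assume "n \<in> {..N}"
      then show "cmod (y n) \<le> c * (\<Sum>m\<le>N. shift_kernel b r n m * cmod (x m))"
        using y[of n] by (simp add: shift_kernel_sum_row)
    qed simp
    also have "\<dots> = c\<^sup>2 * (\<Sum>n\<le>N. (\<Sum>m\<le>N. shift_kernel b r n m * cmod (x m))\<^sup>2)"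
      unfolding power_mult_distrib sum_distrib_left[symmetric] ..
    also have "\<dots> \<le> c\<^sup>2 * (R\<^sup>2 * (\<Sum>m\<le>N. (cmod (x m))\<^sup>2))"
      using r R shift_kernel_row shift_kernel_col less_imp_le[OF weight_pos]
      by (intro mult_left_mono schur_test[where p = "schur_weight b"])
        (auto simp: shift_kernel_def R_def)
    also have "\<dots> \<le> c\<^sup>2 * (R\<^sup>2 * (ip_norm ell2_space x)\<^sup>2)"
      using x by (intro mult_left_mono ell2_sum_le) auto
    finally show ?thesis by (simp add: power_mult_distrib)
  qed
  moreover have "0 \<le> c * R * ip_norm ell2_space x"
    using c R x ell2.ip_norm_nonneg[of x] by simp
  ultimately show "y \<in> ell2"
    and "ip_norm ell2_space y \<le> c * (1 / ((1 - 2 * b) * (1 - r))) * ip_norm ell2_space x"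
    using ell2_boundI[of y] unfolding R_def by blast+
qed

end

section \<open>Boundedness, Kreiss estimate and growth of the powers\<close>

text \<open>T^k is entrywise at most r^(-k) times the kernel, being one term of a nonnegative sum.
  Taking r = 1/2 gives the factors 2^k and 1 / (1-r) = 2; a crude bound is enough to have bounded
  operators.\<close>

lemma wshift_funpow_bounded:
  assumes b: "0 \<le> b" "2 * b < 1" and x: "x \<in> ell2"
  shows "(wshift b ^^ k) x \<in> ell2"
    and "ip_norm ell2_space ((wshift b ^^ k) x) \<le> 2 ^ k * (2 / (1 - 2 * b)) * ip_norm ell2_space x"
proof -
  have "cmod ((wshift b ^^ k) x n)
      \<le> 2 ^ k * (\<Sum>k\<le>pos n. (1 / 2) ^ k * (weight b n / weight b (n - k)) * cmod (x (n - k)))" for n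
  proof (cases "k \<le> pos n")
    case True
    have "(1 / 2) ^ k * (weight b n / weight b (n - k)) * cmod (x (n - k))
        \<le> (\<Sum>k\<le>pos n. (1 / 2) ^ k * (weight b n / weight b (n - k)) * cmod (x (n - k)))"
      using True less_imp_le[OF weight_pos]
      by (intro member_le_sum[where f = "\<lambda>k. (1 / 2) ^ k * (weight b n / weight b (n - k)) * cmod (x (n - k))"])
        auto
    then show ?thesis
      using True less_imp_le[OF weight_pos]
      by (simp add: wshift_funpow norm_mult norm_divide power_one_over field_simps)
  next
    case False
    then show ?thesis
      using less_imp_le[OF weight_pos] by (auto simp: wshift_funpow intro!: sum_nonneg mult_nonneg_nonneg divide_nonneg_nonneg)
  qed
  from shift_kernel_dominated[OF b _ _ x _ this]
  show "(wshift b ^^ k) x \<in> ell2"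
    and "ip_norm ell2_space ((wshift b ^^ k) x) \<le> 2 ^ k * (2 / (1 - 2 * b)) * ip_norm ell2_space x"
    by simp_all
qed

lemma wshift_bounded_operator:
  assumes b: "0 \<le> b" "2 * b < 1"
  shows "wshift b \<in> bounded_operators ell2_space"
  unfolding bounded_operators_def
  using wshift_funpow_bounded[OF b, where k = 1]
  by (auto simp: wshift_def fun_eq_iff algebra_simps add_divide_distrib intro!: exI[of _ "2 * (2 / (1 - 2 * b))"])

lemma wshift_uniformly_kreiss_bounded:
  assumes b: "0 \<le> b" "2 * b < 1"
  shows "uniformly_kreiss_bounded ell2_space (wshift b)"
  unfolding uniformly_kreiss_bounded_def
proof (intro exI[of _ "1 / (1 - 2 * b)"] conjI allI impI)
  fix N :: nat and \<mu> :: complex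
  assume \<mu>: "cmod \<mu> > 1"
  \<comment> \<open>The coefficient of T^k has modulus s^(k+1): s is the ratio r of the kernel, and
    the extra factor s turns 1 / (1-s) into 1 / (|\<mu>| - 1).\<close>
  define s where "s = 1 / cmod \<mu>"
  have s: "0 < s" "s < 1" using \<mu> by (auto simp: s_def divide_less_eq)
  have norm_coeff: "cmod (\<mu> powi (- int k - 1)) = s * s ^ k" for k
  proof -
    have "- int k - 1 = - int (Suc k)" by simp
    then have "cmod (\<mu> powi (- int k - 1)) = cmod \<mu> powi (- int (Suc k))"
      by (simp only: norm_power_int)
    also have "\<dots> = s ^ Suc k"
      by (simp only: power_int_minus power_int_of_nat s_def power_one_over inverse_eq_divide)
    finally show ?thesis by simp
  qed
  have const: "s * (1 / ((1 - 2 * b) * (1 - s))) = 1 / (1 - 2 * b) / (cmod \<mu> - 1)"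
  proof -
    have "s / (1 - s) = 1 / (cmod \<mu> - 1)" using \<mu> by (auto simp: s_def field_simps)
    moreover have "s * (1 / ((1 - 2 * b) * (1 - s))) = 1 / (1 - 2 * b) * (s / (1 - s))" by simp
    ultimately show ?thesis by simp
  qed
  show "op_norm ell2_space (\<lambda>x. \<Oplus>\<^bsub>ell2_space\<^esub>k\<in>{0..N}. (\<mu> powi (- int k - 1)) \<odot>\<^bsub>ell2_space\<^esub> (wshift b ^^ k) x)
      \<le> 1 / (1 - 2 * b) / (cmod \<mu> - 1)"
  proof (rule op_norm_ell2_le)
    fix x assume x: "x \<in> ell2" "ip_norm ell2_space x \<le> 1"
    define y where "y = (\<lambda>n. \<Sum>k\<in>{0..N}. (\<mu> powi (- int k - 1)) * (wshift b ^^ k) x n)"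
    have eq: "(\<Oplus>\<^bsub>ell2_space\<^esub>k\<in>{0..N}. (\<mu> powi (- int k - 1)) \<odot>\<^bsub>ell2_space\<^esub> (wshift b ^^ k) x) = y"
      unfolding y_def using wshift_funpow_bounded(1)[OF b x(1)] by (subst ell2_finsum) auto
    have "cmod (y n)
        \<le> s * (\<Sum>k\<le>pos n. s ^ k * (weight b n / weight b (n - k)) * cmod (x (n - k)))" for n
    proof -
      let ?t = "\<lambda>k. s ^ k * (weight b n / weight b (n - k)) * cmod (x (n - k))"
      have t: "0 \<le> ?t k" for k using s less_imp_le[OF weight_pos] by simp
      have "cmod (y n) \<le> (\<Sum>k\<in>{0..N}. cmod ((\<mu> powi (- int k - 1)) * (wshift b ^^ k) x n))"
        unfolding y_def by (rule norm_sum)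
      also have "\<dots> = (\<Sum>k\<in>{0..N}. if k \<le> pos n then s * ?t k else 0)"
        using less_imp_le[OF weight_pos]
        by (intro sum.cong refl) (auto simp: wshift_funpow norm_mult norm_coeff norm_divide)
      also have "\<dots> = (\<Sum>k\<in>{0..N} \<inter> {..pos n}. s * ?t k)"
        by (simp only: sum.inter_restrict[OF finite_atLeastAtMost] atMost_iff)
      \<comment> \<open>Passing from the partial sum to the whole row makes the bound independent of
        \<open>N\<close>.\<close>
      also have "\<dots> \<le> (\<Sum>k\<le>pos n. s * ?t k)"
        by (intro sum_mono2 mult_nonneg_nonneg[OF less_imp_le[OF s(1)] t]) auto
      finally show ?thesis by (simp add: sum_distrib_left)
    qed
    from shift_kernel_dominated(2)[OF b _ _ x(1) _ this]
    have "ip_norm ell2_space y \<le> 1 / (1 - 2 * b) / (cmod \<mu> - 1) * ip_norm ell2_space x"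
      using s unfolding const by simp
    also have "\<dots> \<le> 1 / (1 - 2 * b) / (cmod \<mu> - 1) * 1"
      using b \<mu> x(2) by (intro mult_left_mono) auto
    finally show "ip_norm ell2_space
        (\<Oplus>\<^bsub>ell2_space\<^esub>k\<in>{0..N}. (\<mu> powi (- int k - 1)) \<odot>\<^bsub>ell2_space\<^esub> (wshift b ^^ k) x)
        \<le> 1 / (1 - 2 * b) / (cmod \<mu> - 1)"
      unfolding eq by simp
  qed
qed (use b in simp)

lemma op_norm_wshift_funpow_ge:
  assumes b: "0 \<le> b" "2 * b < 1"
  shows "(real k + 1) powr (2 * b) \<le> op_norm ell2_space (wshift b ^^ k)"
proof -
  \<comment> \<open>The first index of the block of dimension k + 1. After k steps its basis vector
    reaches the last index, and the weight rises from (k+1)^(-b) to (k+1)^b.\<close>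
  define m where "m = prod_encode (0, k)"
  define e :: "nat \<Rightarrow> complex" where "e = (\<lambda>n. if n = m then 1 else 0)"
  have "(\<Sum>n\<le>N. (cmod (e n))\<^sup>2) \<le> 1\<^sup>2" for N
    by (simp add: e_def if_distrib[of "\<lambda>z. (cmod z)\<^sup>2"] cong: if_cong)
  then have e: "e \<in> ell2" "ip_norm ell2_space e \<le> 1"
    using ell2_boundI[of e 1] by simp_all
  have mk: "pos m = 0" "rem m = k" "pos (m + k) = k" "rem (m + k) = 0"
    using pos_rem_add[of k m] by (simp_all add: m_def)
  have "(wshift b ^^ k) e (m + k) = of_real (weight b (m + k) / weight b m)"
    by (simp add: wshift_funpow mk e_def)
  also have "weight b (m + k) / weight b m = (real k + 1) powr (2 * b)"
    unfolding weight_def mk by (simp add: powr_minus field_simps flip: powr_add)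
  finally have "(real k + 1) powr (2 * b) = cmod ((wshift b ^^ k) e (m + k))"
    by simp
  also have "\<dots> \<le> ip_norm ell2_space ((wshift b ^^ k) e)"
    by (intro ell2_coord_le wshift_funpow_bounded(1) b e)
  also have "\<dots> \<le> op_norm ell2_space (wshift b ^^ k)"
    by (rule op_norm_ell2_ge[OF wshift_funpow_bounded(2)[OF b]]) (use b e in auto)
  finally show ?thesis .
qed

theorem theorem2p3:
  fixes \<epsilon> :: real
  assumes "\<epsilon> > 0"
  shows "\<exists>(H :: (nat \<Rightarrow> complex) inner_prod_space) T.
    complex_hilbert_space H \<and> T \<in> bounded_operators H \<and> uniformly_kreiss_bounded H T \<and>
    (\<forall>k::nat. op_norm H (T ^^ k) \<ge> 1 / 3 * (real k + 1) powr (1 - \<epsilon>))"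
proof -
  \<comment> \<open>Half of the exponent, as the powers grow like (k+1)^(2b). For \<epsilon> > 1 the
    maximum keeps \<open>b\<close> nonnegative, as the monotonicity in Chebyshev's inequality
    requires.\<close>
  define b where "b = max 0 ((1 - \<epsilon>) / 2)"
  have b: "0 \<le> b" "2 * b < 1" using assms by (auto simp: b_def max_def)
  have "1 / 3 * (real k + 1) powr (1 - \<epsilon>) \<le> op_norm ell2_space (wshift b ^^ k)" for k
  proof -
    have "1 / 3 * (real k + 1) powr (1 - \<epsilon>) \<le> (real k + 1) powr (1 - \<epsilon>)" by simp
    also have "\<dots> \<le> (real k + 1) powr (2 * b)"
      by (rule powr_mono) (auto simp: b_def max_def)
    also have "\<dots> \<le> op_norm ell2_space (wshift b ^^ k)"
      by (rule op_norm_wshift_funpow_ge[OF b])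
    finally show ?thesis .
  qed
  then show ?thesis
    using complex_hilbert_space_ell2 wshift_bounded_operator[OF b]
      wshift_uniformly_kreiss_bounded[OF b] by blast
qed

end
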